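(* For $k\geq 2$ and $\mathrm{Re}\,s>k/2$, \[ L_k(s)=\frac{2^{-2s}}{(k-1)!}\sum_{l=0}^{\infty} (-1)^l \binom{-s}{l}\left(\frac{k-1}{4}\right)^{2l} \sum_{j=0}^{k-1}2^jB_{k,j}\,\zeta\!\left(2s+2l-j;\frac{k+3}{4}\right). \]
   Context: For an integer $k\ge 2$, $P_k(x)=\frac{(2x+k-1)(x+1)(x+2)\cdots(x+k-2)}{(k-1)!}$ (for $k=2$ the product $(x+1)\cdots(x+k-2)$ is empty). The Minakshisundaram–Pleijel zeta function of the real projective space $P^k$ is $L_k(s)=\sum_{n=1}^{\infty}\frac{P_k(2n)}{[2n(2n+k-1)]^s}$ for $\mathrm{Re}\,s>k/2$. The constants $B_{k,j}$, $0\le j\le k-1$, are given by $B_{k,j}=\sum_{p=0}^{k-j-1}(-1)^{k+j+1}\binom{j+p}{j}\left(\frac{k-1}{2}\right)^p\left(s_{k,j+p+1}+s_{k-1,j+p}\right)$, where the Stirling numbers of the first kind are defined by $x(x+1)\cdots(x+n-1)=\sum_{m=0}^{n}(-1)^{n+m}s_{n,m}x^m$; equivalently $\sum_{j=0}^{k-1}B_{k,j}x^j=(k-1)!\,P_k\!\left(x-\frac{k-1}{2}\right)$. $\zeta(s;a)=\sum_{n=0}^\infty(n+a)^{-s}$ is the Hurwitz zeta function and $\binom{-s}{l}=\frac{(-s)(-s-1)\cdots(-s-l+1)}{l!}$. *)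

theory Defs
  imports "HOL-Analysis.Analysis" "HOL-Combinatorics.Stirling"
begin

definition proj_P :: "nat \<Rightarrow> real \<Rightarrow> real" where
  "proj_P k x = (2 * x + real k - 1) * (\<Prod>i=1..k-2. x + real i) / fact (k - 1)"

text \<open>
  The series for the zeta function of the real projective space starts at n = 1, hence the
  shift by \<^term>\<open>Suc\<close>. It converges for \<^term>\<open>Re s > k / 2\<close> (see below), which is
  the only region where its value is meaningful. The base of the power is a positive real,
  so \<^term>\<open>(powr)\<close> is the usual power.
\<close>

definition proj_L :: "nat \<Rightarrow> complex \<Rightarrow> complex" where
  "proj_L k s = (\<Sum>n. of_real (proj_P k (2 * real (Suc n)))
     / of_real (2 * real (Suc n) * (2 * real (Suc n) + real k - 1)) powr s)"

text \<open>
  Signed Stirling numbers of the first kind; the library's \<^const>\<open>stirling\<close> are the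
  unsigned ones. The defining identity is the lemma that follows.
\<close>

definition signed_stirling :: "nat \<Rightarrow> nat \<Rightarrow> int" where
  "signed_stirling n m = (-1) ^ (n + m) * int (stirling n m)"

lemma signed_stirling_generating:
  fixes x :: "'a :: comm_ring_1"
  shows "(\<Prod>i<n. x + of_nat i) = (\<Sum>m=0..n. (-1) ^ (n + m) * of_int (signed_stirling n m) * x ^ m)"
proof -
  have *: "(-1) ^ (n + m) * of_int (signed_stirling n m) = (of_nat (stirling n m) :: 'a)" for m
    unfolding signed_stirling_def by (simp flip: mult.assoc power_add)
  show ?thesis
    unfolding * using stirling_pochhammer[of n x]
    by (simp add: pochhammer_prod atLeast0LessThan atLeast0AtMost)
qed

definition proj_B :: "nat \<Rightarrow> nat \<Rightarrow> real" where
  "proj_B k j = (\<Sum>p=0..k-j-1. (-1) ^ (k + j + 1) * real (j + p choose j) * ((real k - 1) / 2) ^ p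
     * of_int (signed_stirling k (j + p + 1) + signed_stirling (k - 1) (j + p)))"

text \<open>
  The Hurwitz zeta function, for real \<^term>\<open>a > 0\<close> and in the half-plane
  \<^term>\<open>Re s > 1\<close> where the series converges; no analytic continuation is intended.
\<close>

definition hurwitz_zeta :: "complex \<Rightarrow> real \<Rightarrow> complex" where
  "hurwitz_zeta s a = (\<Sum>n. of_real (real n + a) powr (-s))"

lemma summable_hurwitz_zeta:
  assumes "a > 0" "Re s > 1"
  shows "summable (\<lambda>n. complex_of_real (real n + a) powr (-s))"
proof (rule summable_comparison_test')
  show "summable (\<lambda>n. real n powr (- Re s))"
    using assms by (simp add: summable_real_powr_iff)
  show "norm (complex_of_real (real n + a) powr (-s)) \<le> real n powr (- Re s)" if "n \<ge> 1" for n
    using that assms by (subst norm_powr_real_powr) (auto intro!: powr_mono2')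
qed

lemma summable_proj_L:
  assumes "k \<ge> 2" "Re s > real k / 2"
  shows "summable (\<lambda>n. complex_of_real (proj_P k (2 * real (Suc n)))
     / of_real (2 * real (Suc n) * (2 * real (Suc n) + real k - 1)) powr s)"
proof -
  define C where "C = (real k + 4) ^ (k - 1)"
  have "summable (\<lambda>n. C * real n powr (real k - 1 - 2 * Re s))"
    using assms by (intro summable_mult) (simp add: summable_real_powr_iff)
  hence S: "summable (\<lambda>n. C * real (Suc n) powr (real k - 1 - 2 * Re s))"
    by (subst (asm) summable_Suc_iff[symmetric])
  have bound: "norm (complex_of_real (proj_P k (2 * x)) / of_real (2 * x * (2 * x + real k - 1)) powr s)
      \<le> C * x powr (real k - 1 - 2 * Re s)" if x: "x \<ge> 1" for x :: real
  proof -
    have kx: "real k \<le> real k * x" using x by (simp add: mult_le_cancel_left1)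
    have prod: "(\<Prod>i=1..k-2. 2 * x + real i) \<le> (\<Prod>i=1..k-2. (real k + 4) * x)"
    proof (intro prod_mono conjI)
      fix i assume "i \<in> {1..k-2}"
      hence "real i \<le> real k" by auto
      thus "2 * x + real i \<le> (real k + 4) * x" using kx x by (simp add: algebra_simps)
    qed (use x in auto)
    have prod0: "0 \<le> (\<Prod>i=1..k-2. 2 * x + real i)"
      using x by (intro prod_nonneg) auto
    have lin: "2 * (2 * x) + real k - 1 \<le> (real k + 4) * x" "0 \<le> 2 * (2 * x) + real k - 1"
      using kx x by (simp_all add: algebra_simps)
    have "(2 * (2 * x) + real k - 1) * (\<Prod>i=1..k-2. 2 * x + real i)
        \<le> ((real k + 4) * x) * ((real k + 4) * x) ^ (k - 2)"
      using prod prod0 lin x by (intro mult_mono) auto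
    also have "\<dots> = C * x ^ (k - 1)"
    proof -
      have "k - 1 = Suc (k - 2)" using assms(1) by simp
      thus ?thesis by (simp add: C_def power_mult_distrib mult_ac)
    qed
    finally have num: "(2 * (2 * x) + real k - 1) * (\<Prod>i=1..k-2. 2 * x + real i) \<le> C * x ^ (k - 1)" .
    have P0: "0 \<le> proj_P k (2 * x)"
      using prod0 lin(2) by (simp add: proj_P_def)
    have "proj_P k (2 * x) \<le> (2 * (2 * x) + real k - 1) * (\<Prod>i=1..k-2. 2 * x + real i) / 1"
      unfolding proj_P_def using prod0 lin(2) by (intro divide_left_mono) (auto simp: fact_ge_1)
    with num have P1: "proj_P k (2 * x) \<le> C * x ^ (k - 1)" by simp
    have base: "x * x \<le> 2 * x * (2 * x + real k - 1)"
      using x assms(1) by (intro mult_mono) auto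
    have "x powr (2 * Re s) = (x * x) powr Re s"
      using x by (simp add: powr_mult flip: powr_add)
    also have "\<dots> \<le> (2 * x * (2 * x + real k - 1)) powr Re s"
      using base x assms by (intro powr_mono2) auto
    finally have den: "x powr (2 * Re s) \<le> (2 * x * (2 * x + real k - 1)) powr Re s" .
    have "norm (complex_of_real (proj_P k (2 * x)) / of_real (2 * x * (2 * x + real k - 1)) powr s)
        = proj_P k (2 * x) / (2 * x * (2 * x + real k - 1)) powr Re s"
      unfolding norm_divide using P0 x assms(1) by (subst norm_powr_real_powr) auto
    also have "\<dots> \<le> C * x ^ (k - 1) / x powr (2 * Re s)"
      using P0 P1 den x by (intro frac_le) auto
    also have "\<dots> = C * x powr (real k - 1 - 2 * Re s)"
      using x assms(1) by (simp add: powr_diff powr_realpow of_nat_diff flip: powr_realpow)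
    finally show ?thesis .
  qed
  show ?thesis
    by (rule summable_comparison_test'[OF S, of 0]) (rule bound, simp)
qed

end

theory Submission
  imports Defs
begin

text \<open>
  Put \<open>c = (k - 1) / 4\<close> and \<open>y = n + c\<close>. The base of the \<open>n\<close>-th term of \<open>L\<close> is then
  \<open>4 (y\<^sup>2 - c\<^sup>2)\<close>, so the binomial series expands the term in powers of \<open>(c / y)\<^sup>2\<close>, while
  \<open>P\<close> becomes the polynomial in \<open>2 y\<close> with coefficients \<open>B\<close>. The double series converges
  absolutely: since \<open>y \<ge> c + 1\<close> (the sum starts at \<open>n = 1\<close>), it is dominated by the product of
  a convergent series in \<open>n\<close> and the binomial series at \<open>(c / (c + 1))\<^sup>2\<close>. Summing over
  \<open>n\<close> first gives the Hurwitz zeta values.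
\<close>

section \<open>Interchange of two infinite sums\<close>

text \<open>The product of two summable nonnegative families is summable over all pairs. Domination
  thus makes \<open>f\<close> absolutely summable over pairs, and its unordered sum can be taken in
  either order.\<close>

lemma suminf_swap_dominated:
  fixes f :: "nat \<Rightarrow> nat \<Rightarrow> 'a :: banach"
  assumes bound: "\<And>m n. norm (f m n) \<le> g m * h n"
    and g: "summable g" and h: "summable h"
    and nonneg: "\<And>m. 0 \<le> g m" "\<And>n. 0 \<le> h n"
  shows "summable (\<lambda>n. \<Sum>m. f m n)"
    and "(\<Sum>m. \<Sum>n. f m n) = (\<Sum>n. \<Sum>m. f m n)"
proof -
  have hs: "(h has_sum suminf h) UNIV"
    using h nonneg by (intro sums_nonneg_imp_has_sum) auto
  have "(\<lambda>(m, n). g m * h n) summable_on UNIV \<times> UNIV"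
  proof (rule summable_on_SigmaI)
    show "((\<lambda>n. case (m, n) of (m, n) \<Rightarrow> g m * h n) has_sum g m * suminf h) UNIV" for m
      using has_sum_cmult_right[OF hs] by simp
    show "(\<lambda>m. g m * suminf h) summable_on UNIV"
      using g nonneg by (intro summable_on_cmult_left summable_nonneg_imp_summable_on) auto
  qed (use nonneg in auto)
  hence "(\<lambda>(m, n). f m n) abs_summable_on UNIV \<times> UNIV"
    by (rule summable_on_comparison_test) (use bound in auto)
  hence F: "(\<lambda>(m, n). f m n) summable_on UNIV \<times> UNIV"
    by (rule abs_summable_summable)
  hence F': "(\<lambda>(n, m). f m n) summable_on UNIV \<times> UNIV"
    by (subst (asm) summable_on_swap) simp
  have row: "f m summable_on UNIV" for m
    using bound by (intro norm_summable_imp_summable_on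
        summable_comparison_test'[OF summable_mult[OF h, of "g m"], of 0]) auto
  have col: "(\<lambda>m. f m n) summable_on UNIV" for n
    using bound by (intro norm_summable_imp_summable_on
        summable_comparison_test'[OF summable_mult2[OF g, of "h n"], of 0]) auto
  have rows: "(\<lambda>m. \<Sum>\<^sub>\<infinity>n. f m n) summable_on UNIV"
    using summable_on_SigmaD[OF F] row by simp
  have cols: "(\<lambda>n. \<Sum>\<^sub>\<infinity>m. f m n) summable_on UNIV"
    using summable_on_SigmaD[OF F'] col by simp
  have suminf: "infsum u UNIV = suminf u" if "u summable_on UNIV" for u :: "nat \<Rightarrow> 'a"
    using has_sum_imp_sums[OF has_sum_infsum[OF that]] by (simp add: sums_iff)
  show "summable (\<lambda>n. \<Sum>m. f m n)"
    using summable_on_imp_summable[OF cols] by (simp add: suminf[OF col])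
  show "(\<Sum>m. \<Sum>n. f m n) = (\<Sum>n. \<Sum>m. f m n)"
    using infsum_swap_banach[OF F] suminf[OF rows] suminf[OF cols]
    by (simp add: suminf[OF row] suminf[OF col])
qed

section \<open>Stirling numbers and the polynomial \<open>proj_P\<close>\<close>

text \<open>This is the generating polynomial of row \<open>Suc n\<close> with one factor
  \<open>x\<close> cancelled. A semiring offers no division by \<open>x\<close>, so the Stirling
  recurrence and induction take its place.\<close>

lemma sum_stirling_Suc_Suc:
  fixes x :: "'a :: comm_semiring_1"
  shows "(\<Sum>m\<le>n. of_nat (stirling (Suc n) (Suc m)) * x ^ m) = pochhammer (x + 1) n"
proof (induction n)
  case (Suc n)
  have "(\<Sum>m\<le>Suc n. of_nat (stirling (Suc (Suc n)) (Suc m)) * x ^ m)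
      = of_nat (Suc n) * (\<Sum>m\<le>Suc n. of_nat (stirling (Suc n) (Suc m)) * x ^ m)
        + (\<Sum>m\<le>Suc n. of_nat (stirling (Suc n) m) * x ^ m)"
    by (simp only: stirling.simps(4)[of "Suc n"] of_nat_add of_nat_mult
        distrib_right sum.distrib sum_distrib_left mult.assoc)
  \<comment> \<open>The extra term \<open>m = Suc n\<close> is zero, so the induction hypothesis
    applies.\<close>
  also have "(\<Sum>m\<le>Suc n. of_nat (stirling (Suc n) (Suc m)) * x ^ m) = pochhammer (x + 1) n"
    by (subst sum.atMost_Suc, subst Suc.IH) simp
  also have "(\<Sum>m\<le>Suc n. of_nat (stirling (Suc n) m) * x ^ m) = x * pochhammer (x + 1) n"
    by (simp only: stirling_pochhammer pochhammer_rec)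
  also have "of_nat (Suc n) * pochhammer (x + 1) n + x * pochhammer (x + 1) n
      = pochhammer (x + 1) (Suc n)"
    by (simp add: pochhammer_Suc algebra_simps)
  finally show ?case .
qed simp

text \<open>Splitting \<open>2 * x + k - 1\<close> as \<open>x + (x + k - 1)\<close> turns the
  numerator of \<open>proj_P\<close> into two rising factorials of length \<open>k - 1\<close>,
  starting at \<open>x\<close> and at \<open>x + 1\<close>.\<close>

lemma proj_P_stirling:
  assumes "k \<ge> 2"
  shows "fact (k - 1) * proj_P k x
    = (\<Sum>m\<le>k - 1. real (stirling k (Suc m) + stirling (k - 1) m) * x ^ m)"
proof -
  define r where "r = k - 2"
  have k: "k = Suc (Suc r)" using assms by (simp add: r_def)
  have "(\<Sum>m\<le>k - 1. real (stirling k (Suc m) + stirling (k - 1) m) * x ^ m)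
      = pochhammer (x + 1) (Suc r) + pochhammer x (Suc r)"
    by (simp only: k diff_Suc_1 of_nat_add distrib_right sum.distrib
        sum_stirling_Suc_Suc stirling_pochhammer)
  also have "\<dots> = (2 * x + real k - 1) * pochhammer (x + 1) r"
    by (subst pochhammer_rec[of x], subst pochhammer_Suc) (simp add: k algebra_simps)
  also have "pochhammer (x + 1) r = (\<Prod>i=1..k-2. x + real i)"
    unfolding pochhammer_prod
    by (rule prod.reindex_bij_witness[of _ "\<lambda>i. i - 1" Suc]) (auto simp: k)
  finally show ?thesis by (simp add: proj_P_def)
qed

text \<open>Taylor shift of a polynomial: expand each power binomially and regroup the triangle of
  pairs with \<open>m = j + p\<close> by the power of \<open>x\<close>.\<close>

lemma sum_power_shift:
  fixes x y :: "'a :: comm_ring_1"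
  shows "(\<Sum>m\<le>n. a m * (x + y) ^ m)
    = (\<Sum>j\<le>n. (\<Sum>p\<le>n - j. of_nat (j + p choose j) * y ^ p * a (j + p)) * x ^ j)"
proof -
  have "(\<Sum>m\<le>n. a m * (x + y) ^ m)
      = (\<Sum>m\<le>n. \<Sum>j\<le>m. of_nat (j + (m - j) choose j) * y ^ (m - j) * a (j + (m - j)) * x ^ j)"
    by (auto simp: binomial_ring sum_distrib_left mult_ac intro!: sum.cong)
  also have "\<dots> = (\<Sum>(j, p)\<in>{(j, p). j + p \<le> n}. of_nat (j + p choose j) * y ^ p * a (j + p) * x ^ j)"
    by (rule sum.triangle_reindex_eq[symmetric])
  also have "{(j, p). j + p \<le> n} = Sigma {..n} (\<lambda>j. {..n - j})"
    by auto
  finally show ?thesis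
    by (simp add: sum.Sigma sum_distrib_right)
qed

text \<open>The coefficients \<open>proj_B\<close> are those of the Stirling expansion after the
  shift by \<open>h\<close>.\<close>

lemma proj_B_generating:
  assumes "k \<ge> 2"
  shows "(\<Sum>j=0..k-1. proj_B k j * x ^ j) = fact (k - 1) * proj_P k (x - (real k - 1) / 2)"
proof -
  define h where "h = - ((real k - 1) / 2)"
  have B: "proj_B k j = (\<Sum>p\<le>k - 1 - j. real (j + p choose j) * h ^ p
      * real (stirling k (Suc (j + p)) + stirling (k - 1) (j + p)))" if "j \<le> k - 1" for j
  proof -
    \<comment> \<open>Both signed Stirling numbers carry the sign
      \<open>(-1) ^ (k + j + p + 1)\<close>. What remains is \<open>(-1) ^ p\<close>, the sign of
      \<open>h ^ p\<close>.\<close>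
    have sgn: "(-1) ^ (k + j + 1) * of_int (signed_stirling k (j + p + 1) + signed_stirling (k - 1) (j + p))
        = (-1) ^ p * real (stirling k (Suc (j + p)) + stirling (k - 1) (j + p))" for p
    proof -
      obtain r where "k = Suc r" using assms by (cases k) auto
      thus ?thesis
        by (simp add: signed_stirling_def minus_one_power_iff)
    qed
    have "h ^ p = (-1) ^ p * ((real k - 1) / 2) ^ p" for p
      unfolding h_def by (rule power_minus)
    hence "(-1) ^ (k + j + 1) * real (j + p choose j) * ((real k - 1) / 2) ^ p
        * of_int (signed_stirling k (j + p + 1) + signed_stirling (k - 1) (j + p))
      = real (j + p choose j) * h ^ p
        * real (stirling k (Suc (j + p)) + stirling (k - 1) (j + p))" for p
      using arg_cong[OF sgn[of p], of "\<lambda>u. real (j + p choose j) * ((real k - 1) / 2) ^ p * u"]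
      by (simp only: mult_ac)
    thus ?thesis
      unfolding proj_B_def atLeast0AtMost by (intro sum.cong) auto
  qed
  have "(\<Sum>j=0..k-1. proj_B k j * x ^ j)
    = (\<Sum>m\<le>k - 1. real (stirling k (Suc m) + stirling (k - 1) m) * (x + h) ^ m)"
    by (subst sum_power_shift) (simp add: B atLeast0AtMost)
  thus ?thesis
    by (simp only: proj_P_stirling[OF assms]) (simp add: h_def)
qed

section \<open>Absolute convergence and the binomial expansion\<close>

text \<open>The moduli are the terms of the series at the real argument \<open>Re s\<close>.\<close>

lemma summable_norm_hurwitz_zeta:
  assumes "a > 0" "Re s > 1"
  shows "summable (\<lambda>n. norm (complex_of_real (real n + a) powr (-s)))"
proof -
  have "summable (\<lambda>n. complex_of_real (real n + a) powr (- of_real (Re s)))"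
    using assms by (intro summable_hurwitz_zeta) auto
  also have "(\<lambda>n. complex_of_real (real n + a) powr (- of_real (Re s)))
      = (\<lambda>n. of_real ((real n + a) powr (- Re s)))"
    using assms by (subst powr_of_real[symmetric]) auto
  finally have "summable (\<lambda>n. (real n + a) powr (- Re s))"
    by (simp add: summable_of_real_iff)
  thus ?thesis
    using assms by (subst norm_powr_real_powr) auto
qed

lemma summable_norm_gchoose_powser:
  fixes a z :: complex
  assumes "norm z < 1"
  shows "summable (\<lambda>n. norm ((a gchoose n) * z ^ n))"
  using assms by (intro abs_summable_in_conv_radius) (auto simp: conv_radius_gchoose one_ereal_def)

text \<open>Factor out \<open>y\<^sup>2\<close> and apply the binomial series at
  \<open>- (c / y)\<^sup>2\<close>, which lies inside the unit disc.\<close>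

lemma powr_square_diff_sums:
  fixes y c :: real and s :: complex
  assumes "0 \<le> c" "c < y"
  shows "(\<lambda>l. (-1) ^ l * ((-s) gchoose l) * of_real c ^ (2 * l)
      * (of_real y powr (-2 * s) / of_real y ^ (2 * l)))
    sums (of_real (y\<^sup>2 - c\<^sup>2) powr (-s))"
proof -
  have y: "y > 0" using assms by simp
  have lt: "c\<^sup>2 < y\<^sup>2" using assms by (intro power_strict_mono) auto
  define z where "z = c\<^sup>2 / y\<^sup>2"
  have z: "0 \<le> z" "z < 1" using lt y by (auto simp: z_def)
  have "(\<lambda>l. ((-s) gchoose l) * (- of_real z) ^ l) sums (1 + - complex_of_real z) powr (-s)"
    using z by (intro gen_binomial_complex) simp
  hence "(\<lambda>l. of_real y powr (-2 * s) * (((-s) gchoose l) * (- of_real z) ^ l))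
      sums (of_real y powr (-2 * s) * (1 + - complex_of_real z) powr (-s))"
    by (rule sums_mult)
  moreover have "of_real y powr (-2 * s) * (1 + - complex_of_real z) powr (-s)
      = of_real (y\<^sup>2 - c\<^sup>2) powr (-s)"
  proof -
    have "y\<^sup>2 - c\<^sup>2 = (y * y) * (1 - z)"
      using y by (simp add: z_def field_simps power2_eq_square)
    hence "of_real (y\<^sup>2 - c\<^sup>2) powr (-s) = (of_real (y * y) * complex_of_real (1 - z)) powr (-s)"
      by (simp only: of_real_mult)
    \<comment> \<open>Complex powers are not multiplicative in general; here the factor pulled out
      is a nonnegative real.\<close>
    also have "\<dots> = of_real (y * y) powr (-s) * complex_of_real (1 - z) powr (-s)"
      by (subst powr_times_real_left) auto
    also have "of_real (y * y) powr (-s) = complex_of_real y powr (-s) * of_real y powr (-s)"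
      using y by (subst of_real_mult, subst powr_times_real_left) auto
    also have "\<dots> = of_real y powr (-2 * s)"
      by (simp flip: powr_add)
    finally show ?thesis by simp
  qed
  moreover have "of_real y powr (-2 * s) * (((-s) gchoose l) * (- of_real z) ^ l)
      = (-1) ^ l * ((-s) gchoose l) * of_real c ^ (2 * l)
        * (of_real y powr (-2 * s) / of_real y ^ (2 * l))" for l
    by (subst power_minus) (simp add: z_def power_divide power_mult)
  ultimately show ?thesis by simp
qed

section \<open>The double series behind \<open>proj_L\<close> and its two orders of
  summation\<close>

theorem theorem11:
  fixes k :: nat and s :: complex
  assumes "k \<ge> 2" and "Re s > real k / 2"
  shows "summable (\<lambda>l. (-1) ^ l * ((-s) gchoose l) * ((of_nat k - 1) / 4) ^ (2 * l)
           * (\<Sum>j=0..k-1. 2 ^ j * of_real (proj_B k j)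
                * hurwitz_zeta (2 * s + 2 * of_nat l - of_nat j) ((real k + 3) / 4)))
    \<and> proj_L k s = 2 powr (-2 * s) / fact (k - 1)
        * (\<Sum>l. (-1) ^ l * ((-s) gchoose l) * ((of_nat k - 1) / 4) ^ (2 * l)
           * (\<Sum>j=0..k-1. 2 ^ j * of_real (proj_B k j)
                * hurwitz_zeta (2 * s + 2 * of_nat l - of_nat j) ((real k + 3) / 4)))"
proof -
  define a where "a = (real k + 3) / 4"
  define c where "c = (real k - 1) / 4"
  \<comment> \<open>Indices start at 0 here, so \<open>y n\<close> equals \<open>Suc n + c\<close>;
    this is why the Hurwitz parameter is \<open>a = c + 1\<close>.\<close>
  define y where "y n = real n + a" for n :: nat
  have a: "a > 0" "a = c + 1" and c: "c > 0"
    using assms by (simp_all add: a_def c_def field_simps)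
  have cy: "c < y n" "y n > 0" "c / y n \<le> c / a" for n
    using a c by (auto simp: y_def intro!: divide_left_mono)
  have ca: "c / a < 1" "0 \<le> c / a" using a c by (auto simp: field_simps)
  define Q where "Q n = (\<Sum>j=0..k-1. 2 ^ j * proj_B k j * y n ^ j)" for n
  define T where "T l = (-1) ^ l * ((-s) gchoose l) * complex_of_real c ^ (2 * l)" for l
  define G where "G n = complex_of_real (Q n) * of_real (y n) powr (-2 * s)" for n
  define f where "f n l = T l * (G n / of_real (y n) ^ (2 * l))" for n l

  have Q: "Q n = fact (k - 1) * proj_P k (2 * real (Suc n))" for n
  proof -
    have "2 * y n - (real k - 1) / 2 = 2 * real (Suc n)"
      by (simp add: y_def a_def field_simps)
    thus ?thesis
      using proj_B_generating[OF assms(1), of "2 * y n"]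
      by (simp add: Q_def power_mult_distrib mult_ac)
  qed

  have G_split: "G n / of_real (y n) ^ (2 * l)
      = (\<Sum>j=0..k-1. 2 ^ j * of_real (proj_B k j)
          * of_real (y n) powr (- (2 * s + 2 * of_nat l - of_nat j)))" for n l
  proof -
    have "complex_of_real (y n) powr (- (2 * s + 2 * of_nat l - of_nat j))
        = of_real (y n) powr (-2 * s) / of_real (y n) ^ (2 * l) * of_real (y n) ^ j" for j
    proof -
      have "- (2 * s + 2 * of_nat l - of_nat j) = (-2 * s - of_nat (2 * l)) + of_nat j" by simp
      thus ?thesis
        using cy(2)[of n] by (simp only: powr_add powr_diff powr_nat) simp
    qed
    thus ?thesis
      by (simp add: G_def Q_def sum_distrib_left sum_distrib_right sum_divide_distrib mult_ac)
  qed

  \<comment> \<open>The worst case is \<open>l = 0\<close>, \<open>j = k - 1\<close>, where the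
    bound is exactly \<open>Re s > k / 2\<close>.\<close>
  have re: "Re (2 * s + 2 * of_nat l - of_nat j) > 1" if "j \<le> k - 1" for l j
    using that assms by (simp add: of_nat_diff)

  have zeta: "(\<lambda>n. G n / of_real (y n) ^ (2 * l)) sums
      (\<Sum>j=0..k-1. 2 ^ j * of_real (proj_B k j) * hurwitz_zeta (2 * s + 2 * of_nat l - of_nat j) a)" for l
    unfolding G_split unfolding hurwitz_zeta_def y_def
    using a re by (intro sums_sum sums_mult summable_sums summable_hurwitz_zeta) auto

  \<comment> \<open>This is the case \<open>l = 0\<close> of \<open>G_split\<close>;
    \<open>of_nat 0\<close> is kept unsimplified so that \<open>re\<close> matches.\<close>
  have G: "summable (\<lambda>n. norm (G n))"
  proof (rule summable_comparison_test'[of _ 0])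
    show "summable (\<lambda>n. \<Sum>j=0..k-1. norm (2 ^ j * complex_of_real (proj_B k j))
        * norm (complex_of_real (y n) powr (- (2 * s + 2 * of_nat 0 - of_nat j))))"
      unfolding y_def using a re
      by (intro summable_sum summable_mult summable_norm_hurwitz_zeta) (auto simp del: of_nat_0)
    show "norm (norm (G n)) \<le> (\<Sum>j=0..k-1. norm (2 ^ j * complex_of_real (proj_B k j))
        * norm (complex_of_real (y n) powr (- (2 * s + 2 * of_nat 0 - of_nat j))))" for n
      using G_split[of n 0] norm_sum[of "\<lambda>j. 2 ^ j * of_real (proj_B k j)
          * of_real (y n) powr (- (2 * s + 2 * of_nat 0 - of_nat j))" "{0..k-1}"]
      by (simp add: norm_mult)
  qed

  \<comment> \<open>The smallest \<open>y n\<close> is \<open>y 0 = a\<close>, so the ratio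
    \<open>c / a < 1\<close> bounds \<open>c / y n\<close> uniformly in \<open>n\<close>.\<close>
  define h where "h l = norm (((-s) gchoose l) * complex_of_real ((c / a)\<^sup>2) ^ l)" for l
  have h: "summable h"
    unfolding h_def using ca by (intro summable_norm_gchoose_powser) (simp add: power_less_one_iff del: of_real_power of_real_divide)
  have h_nonneg: "0 \<le> h l" for l by (simp add: h_def)
  have bound: "norm (f n l) \<le> norm (G n) * h l" for n l
  proof -
    have "norm (f n l) = norm (G n) * (norm ((-s) gchoose l) * (c / y n) ^ (2 * l))"
      using c cy(2)[of n]
      by (simp add: f_def T_def norm_mult norm_divide norm_power power_divide)
    also have "\<dots> \<le> norm (G n) * (norm ((-s) gchoose l) * (c / a) ^ (2 * l))"
      using c cy(2,3)[of n] by (intro mult_left_mono power_mono) auto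
    also have "\<dots> = norm (G n) * h l"
      using ca by (simp add: h_def norm_mult norm_power power_mult del: of_real_power of_real_divide)
    finally show ?thesis .
  qed
  \<comment> \<open>Summability in \<open>l\<close> and the exchange of sums, the two halves of the
    claim, both come from here.\<close>
  note swap = suminf_swap_dominated[OF bound G h norm_ge_zero h_nonneg]

  have inner: "(\<Sum>n. f n l) = T l * (\<Sum>j=0..k-1. 2 ^ j * of_real (proj_B k j)
      * hurwitz_zeta (2 * s + 2 * of_nat l - of_nat j) a)" for l
    unfolding f_def using sums_mult[OF zeta, of "T l"] by (simp add: sums_iff)

  have outer: "of_real (proj_P k (2 * real (Suc n)))
        / of_real (2 * real (Suc n) * (2 * real (Suc n) + real k - 1)) powr s
      = 2 powr (-2 * s) / fact (k - 1) * (\<Sum>l. f n l)" for n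
  proof -
    have "(\<lambda>l. of_real (Q n) * (T l * (of_real (y n) powr (-2 * s) / of_real (y n) ^ (2 * l))))
        sums (of_real (Q n) * of_real ((y n)\<^sup>2 - c\<^sup>2) powr (-s))"
      unfolding T_def using c cy by (intro sums_mult powr_square_diff_sums) auto
    hence "(\<Sum>l. f n l) = of_real (Q n) * of_real ((y n)\<^sup>2 - c\<^sup>2) powr (-s)"
      by (simp add: f_def G_def sums_iff mult_ac)
    moreover have "of_real (2 * real (Suc n) * (2 * real (Suc n) + real k - 1)) powr s
        = 2 powr (2 * s) * complex_of_real ((y n)\<^sup>2 - c\<^sup>2) powr s"
    proof -
      \<comment> \<open>The factor 4 is kept as \<open>2 * 2\<close> so that its power becomes
        \<open>2 powr (2 * s)\<close>.\<close>
      have "2 * real (Suc n) * (2 * real (Suc n) + real k - 1) = (2 * 2) * ((y n)\<^sup>2 - c\<^sup>2)"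
        by (simp add: y_def a_def c_def field_simps power2_eq_square)
      hence "of_real (2 * real (Suc n) * (2 * real (Suc n) + real k - 1)) powr s
          = (2 * 2 * complex_of_real ((y n)\<^sup>2 - c\<^sup>2)) powr s"
        by simp
      also have "\<dots> = (2 powr s * 2 powr s) * complex_of_real ((y n)\<^sup>2 - c\<^sup>2) powr s"
        by (subst mult.assoc, subst powr_times_real_left, simp, simp,
            subst powr_times_real_left) (simp_all add: mult.assoc)
      also have "2 powr s * 2 powr s = (2 :: complex) powr (2 * s)"
        by (simp flip: powr_add)
      finally show ?thesis .
    qed
    ultimately show ?thesis
      by (simp add: Q powr_minus field_simps)
  qed

  \<comment> \<open>\<open>swap\<close> gives summability only in \<open>l\<close>. In
    \<open>n\<close> it follows from the convergence of the series for \<open>proj_L\<close> by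
    cancelling the nonzero constant.\<close>
  have summable_outer: "summable (\<lambda>n. \<Sum>l. f n l)"
  proof -
    have "summable (\<lambda>n. fact (k - 1) / 2 powr (-2 * s) *
        (2 powr (-2 * s) / fact (k - 1) * (\<Sum>l. f n l)))"
      using summable_proj_L[OF assms] unfolding outer by (rule summable_mult)
    thus ?thesis by (simp add: mult.assoc[symmetric])
  qed
  have L: "proj_L k s = 2 powr (-2 * s) / fact (k - 1) * (\<Sum>n. \<Sum>l. f n l)"
    unfolding proj_L_def outer by (rule suminf_mult[OF summable_outer])
  have c': "complex_of_real c = (of_nat k - 1) / 4" by (simp add: c_def)
  show ?thesis
    using swap L unfolding inner T_def a_def c' by simp
qed

end
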